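(* Let $a$, $b$, and $n$ be positive integers. Then \[ \frac {1-q^{\gcd(an,bn+1)}} {1-q^{bn+1}}\begin{bmatrix} an+bn\\ an\end{bmatrix}_q =\frac {1-q^{\gcd(an,bn+1)}} {1-q^{an+bn+1}}\begin{bmatrix} an+bn+1\\ an\end{bmatrix}_q \] is a polynomial in $q$ with non-negative coefficients.
   Context: The $q$-binomial coefficients (Gaussian polynomials) are defined by $\begin{bmatrix} n\\ k\end{bmatrix}_q=\frac{(1-q^n)(1-q^{n-1})\cdots(1-q)}{(1-q^k)(1-q^{k-1})\cdots(1-q)(1-q^{n-k})(1-q^{n-k-1})\cdots(1-q)}$ if $0\le k\le n$, and $0$ otherwise. *)

theory Defs
  imports "HOL-Computational_Algebra.Computational_Algebra"
begin

definition qbinomial :: "'a::field \<Rightarrow> nat \<Rightarrow> nat \<Rightarrow> 'a" where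
  "qbinomial q n k =
     (if k \<le> n
      then (\<Prod>i=1..n. 1 - q ^ i) /
           ((\<Prod>i=1..k. 1 - q ^ i) * (\<Prod>i=1..n - k. 1 - q ^ i))
      else 0)"

text \<open>The indeterminate of the field of fractions of the integer polynomial ring. As it is
  transcendental, no denominator \<open>1 - qvar ^ i\<close> with \<open>i > 0\<close> vanishes.\<close>

definition qvar :: "int poly fract" where
  "qvar = to_fract [:0, 1:]"

definition is_nonneg_poly :: "int poly fract \<Rightarrow> bool" where
  "is_nonneg_poly f \<longleftrightarrow> (\<exists>p :: int poly. f = to_fract p \<and> (\<forall>i. coeff p i \<ge> 0))"

end

theory Submission
  imports Defs
begin

text \<open>
  With \<open>k = a n\<close>, \<open>N = a n + b n + 1\<close> and \<open>d = gcd k N\<close>, the claim is that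
  \<open>(1 - q\<^sup>d) / (1 - q\<^sup>N)\<close> times the Gaussian polynomial \<open>[N, k]\<close> has non-negative coefficients.
  It is a polynomial because \<open>1 - q\<^sup>N\<close> divides both \<open>(1 - q\<^sup>k) [N, k]\<close> and
  \<open>(1 - q\<^sup>N) [N, k]\<close>, hence by Bezout also \<open>(1 - q\<^sup>d) [N, k]\<close>. Non-negativity follows from the
  unimodality of \<open>[N, k]\<close>. Up to a power of \<open>q\<close>, the coefficients of \<open>[N, k]\<close> count the
  \<open>k\<close>-subsets of \<open>{0..<N}\<close> with a given sum; a weighted raising matrix \<open>U\<close> between consecutive
  sums satisfies \<open>U\<^sup>T U - U U\<^sup>T = \<lambda> I\<close> with \<open>\<lambda> > 0\<close> below the middle and \<open>\<lambda> < 0\<close>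
  above it, so that \<open>U\<close>, respectively its transpose, is injective there.
\<close>

section \<open>Linear algebra: homogeneous systems with fewer equations than unknowns\<close>

text \<open>Gaussian elimination by induction on the equations. If some unknown \<open>x0\<close>
  has a nonzero coefficient in equation \<open>y\<close>, that equation determines
  \<open>f x0\<close> from the other values, and substituting removes one equation and one
  unknown.\<close>

lemma nontrivial_kernel:
  fixes M :: "'a \<Rightarrow> 'b \<Rightarrow> 'c::field"
  assumes "finite B" "finite A" "card B < card A"
  shows "\<exists>f. (\<exists>x\<in>A. f x \<noteq> 0) \<and> (\<forall>y\<in>B. (\<Sum>x\<in>A. M x y * f x) = 0)"
  using assms
proof (induction B arbitrary: A M rule: finite_induct)
  case empty
  then obtain x where "x \<in> A" by fastforce
  then show ?case by (intro exI[of _ "\<lambda>_. 1"]) auto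
next
  case (insert y B)
  show ?case
  proof (cases "\<forall>x\<in>A. M x y = 0")
    case True
    have "card B < card A" using insert by simp
    from insert.IH[OF insert.prems(1) this, of M]
    obtain f where "\<exists>x\<in>A. f x \<noteq> 0" "\<forall>z\<in>B. (\<Sum>x\<in>A. M x z * f x) = 0" by blast
    then show ?thesis using True by (intro exI[of _ f]) simp
  next
    case False
    then obtain x0 where x0: "x0 \<in> A" "M x0 y \<noteq> 0" by auto
    define A' where "A' = A - {x0}"
    have A': "finite A'" "card B < card A'" "A = insert x0 A'" "x0 \<notin> A'"
      using insert.hyps insert.prems x0 by (auto simp: A'_def)
    \<comment> \<open>The coefficients left after \<open>x0\<close> has been eliminated by means of
      equation \<open>y\<close>; \<open>c\<close> below is the value that \<open>y\<close> then
      forces at \<open>x0\<close>.\<close>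
    from insert.IH[OF A'(1,2), of "\<lambda>x z. M x z - M x0 z * M x y / M x0 y"]
    obtain f where f: "\<exists>x\<in>A'. f x \<noteq> 0"
      "\<And>z. z \<in> B \<Longrightarrow> (\<Sum>x\<in>A'. (M x z - M x0 z * M x y / M x0 y) * f x) = 0" by blast
    define c where "c = - (\<Sum>x\<in>A'. M x y * f x) / M x0 y"
    define g where "g = f(x0 := c)"
    have g: "(\<Sum>x\<in>A. M x z * g x) = M x0 z * c + (\<Sum>x\<in>A'. M x z * f x)" for z
    proof -
      have "(\<Sum>x\<in>A'. M x z * g x) = (\<Sum>x\<in>A'. M x z * f x)"
        using A'(4) by (intro sum.cong) (auto simp: g_def)
      then show ?thesis using A' by (simp add: g_def)
    qed
    have "(\<Sum>x\<in>A. M x z * g x) = 0" if "z \<in> insert y B" for z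
    proof (cases "z = y")
      case True
      then show ?thesis using x0 by (simp add: g c_def)
    next
      case False
      then have "0 = (\<Sum>x\<in>A'. (M x z - M x0 z * M x y / M x0 y) * f x)"
        using that f by simp
      also have "\<dots> = (\<Sum>x\<in>A'. M x z * f x - M x0 z / M x0 y * (M x y * f x))"
        by (intro sum.cong) (auto simp: algebra_simps)
      also have "\<dots> = (\<Sum>x\<in>A'. M x z * f x) - M x0 z / M x0 y * (\<Sum>x\<in>A'. M x y * f x)"
        by (simp only: sum_subtractf sum_distrib_left)
      finally show ?thesis unfolding g by (simp add: c_def)
    qed
    moreover have "\<exists>x\<in>A. g x \<noteq> 0"
      using f(1) A'(3,4) by (auto simp: g_def)
    ultimately show ?thesis by blast
  qed
qed

section \<open>Unimodality of the subset sum counts\<close>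

definition raises :: "nat \<Rightarrow> nat set \<Rightarrow> nat set \<Rightarrow> bool" where
  "raises i S T \<longleftrightarrow> i \<in> S \<and> Suc i \<notin> S \<and> T = insert (Suc i) (S - {i})"

text \<open>The square root makes the lowering operator the transpose of the raising operator, so
  that norms can be compared; the commutator involves only the squares.\<close>

definition raise_weight :: "nat \<Rightarrow> nat \<Rightarrow> real" where
  "raise_weight p i = sqrt (real (Suc i) * (real p - real i))"

definition raise_matrix :: "nat \<Rightarrow> nat set \<Rightarrow> nat set \<Rightarrow> real" where
  "raise_matrix p S T = (\<Sum>i<p. raise_weight p i * of_bool (raises i S T))"

definition k_subsets :: "nat \<Rightarrow> nat \<Rightarrow> nat set set" where
  "k_subsets n k = {S. S \<subseteq> {..<n} \<and> card S = k}"

definition subset_sum_count :: "nat \<Rightarrow> nat \<Rightarrow> nat \<Rightarrow> nat" where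
  "subset_sum_count n k s = card {S \<in> k_subsets n k. \<Sum>S = s}"

lemma finite_k_subsets [simp]: "finite (k_subsets n k)"
  by (rule finite_subset[of _ "Pow {..<n}"]) (auto simp: k_subsets_def)

lemma raises_iff_lower:
  "raises i S T \<longleftrightarrow> Suc i \<in> T \<and> i \<notin> T \<and> S = insert i (T - {Suc i})"
  unfolding raises_def by auto

lemma raises_card:
  assumes "raises i S T" "finite S"
  shows "card T = card S"
proof -
  have "card T = Suc (card (S - {i}))"
    using assms by (auto simp: raises_def)
  also have "\<dots> = card S"
    using assms by (intro card_Suc_Diff1) (auto simp: raises_def)
  finally show ?thesis .
qed

lemma raises_sum:
  assumes "raises i S T" "finite S"
  shows "\<Sum>T = Suc (\<Sum>S)"
proof -
  have "\<Sum>T = Suc i + \<Sum>(S - {i})"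
    using assms by (auto simp: raises_def)
  moreover have "\<Sum>S = i + \<Sum>(S - {i})"
    using assms by (intro sum.remove) (auto simp: raises_def)
  ultimately show ?thesis by simp
qed

lemma raises_k_subsets:
  assumes "raises i S T" "i < p"
  shows "S \<in> k_subsets (Suc p) k \<longleftrightarrow> T \<in> k_subsets (Suc p) k"
proof -
  have "S \<subseteq> {..<Suc p} \<longleftrightarrow> T \<subseteq> {..<Suc p}"
    using assms by (auto simp: raises_def)
  moreover have "card T = card S" if "S \<subseteq> {..<Suc p}"
    using raises_card[OF assms(1)] that finite_subset by blast
  ultimately show ?thesis by (auto simp: k_subsets_def)
qed

text \<open>Two different moves commute, so a common successor of \<open>S\<close> and
  \<open>S'\<close> corresponds to a common predecessor. This makes the terms with
  \<open>i \<noteq> j\<close> cancel in the commutator.\<close>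

lemma raises_exchange:
  assumes "i \<noteq> j"
  shows "(\<exists>T. raises i S T \<and> raises j S' T) \<longleftrightarrow> (\<exists>R. raises i R S' \<and> raises j R S)"
proof
  assume "\<exists>T. raises i S T \<and> raises j S' T"
  then obtain T where T: "raises i S T" "raises j S' T" by blast
  then have T': "Suc i \<in> T" "i \<notin> T" "Suc j \<in> T" "j \<notin> T"
    and S: "S = insert i (T - {Suc i})" "S' = insert j (T - {Suc j})"
    by (simp_all add: raises_iff_lower)
  \<comment> \<open>The two moves cannot share a position, since \<open>Suc i\<close> lies in
    \<open>T\<close> and \<open>j\<close> does not, and likewise with \<open>i\<close> and
    \<open>j\<close> exchanged.\<close>
  then have ne: "Suc i \<noteq> j" "Suc j \<noteq> i" by metis+
  define R where "R = insert i (insert j (T - {Suc i, Suc j}))"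
  have "raises i R S'" unfolding raises_def R_def S using T' ne assms by auto
  moreover have "raises j R S" unfolding raises_def R_def S using T' ne assms by auto
  ultimately show "\<exists>R. raises i R S' \<and> raises j R S" by blast
next
  assume "\<exists>R. raises i R S' \<and> raises j R S"
  then obtain R where R: "raises i R S'" "raises j R S" by blast
  then have R': "Suc i \<notin> R" "i \<in> R" "Suc j \<notin> R" "j \<in> R"
    and S: "S' = insert (Suc i) (R - {i})" "S = insert (Suc j) (R - {j})"
    by (simp_all add: raises_def)
  then have ne: "Suc i \<noteq> j" "Suc j \<noteq> i" by metis+
  define T where "T = insert (Suc i) (insert (Suc j) (R - {i, j}))"
  have "raises i S T" unfolding raises_def T_def S using R' ne assms by auto
  moreover have "raises j S' T" unfolding raises_def T_def S using R' ne assms by auto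
  ultimately show "\<exists>T. raises i S T \<and> raises j S' T" by blast
qed

lemma sum_of_bool_unique:
  assumes "finite K" "\<And>x. P x \<Longrightarrow> x \<in> K" "\<And>x y. P x \<Longrightarrow> P y \<Longrightarrow> x = y"
  shows "(\<Sum>x\<in>K. of_bool (P x)) = (of_bool (\<exists>x. P x) :: real)"
proof (cases "\<exists>x. P x")
  case True
  then obtain x where x: "P x" by blast
  then have "P y \<longleftrightarrow> y = x" for y using assms(3) by blast
  then show ?thesis using assms(1,2) x by (simp add: of_bool_def)
qed simp

text \<open>A move \<open>i\<close> applied to \<open>S\<close> has at most one result, so once
  \<open>K\<close> contains all results the sum over \<open>T\<close> collapses to an existence
  statement.\<close>

lemma raise_matrix_product:
  assumes "finite K" "\<And>i T. i < p \<Longrightarrow> raises i S T \<Longrightarrow> T \<in> K"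
  shows "(\<Sum>T\<in>K. raise_matrix p S T * raise_matrix p S' T) =
    (\<Sum>i<p. \<Sum>j<p. raise_weight p i * raise_weight p j * of_bool (\<exists>T. raises i S T \<and> raises j S' T))"
proof -
  have "(\<Sum>T\<in>K. raise_matrix p S T * raise_matrix p S' T) =
    (\<Sum>T\<in>K. \<Sum>i<p. \<Sum>j<p. raise_weight p i * raise_weight p j * of_bool (raises i S T \<and> raises j S' T))"
    unfolding raise_matrix_def sum_product by (intro sum.cong) (auto simp: of_bool_def)
  also have "\<dots> = (\<Sum>i<p. \<Sum>j<p. \<Sum>T\<in>K. raise_weight p i * raise_weight p j * of_bool (raises i S T \<and> raises j S' T))"
    by (subst sum.swap, intro sum.cong refl, subst sum.swap) simp
  also have "\<dots> = (\<Sum>i<p. \<Sum>j<p. raise_weight p i * raise_weight p j * of_bool (\<exists>T. raises i S T \<and> raises j S' T))"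
    unfolding sum_distrib_left[symmetric]
    by (intro sum.cong refl, subst sum_of_bool_unique) (use assms in \<open>auto simp: raises_def\<close>)
  finally show ?thesis .
qed

lemma raise_matrix_product_transpose:
  assumes "finite K" "\<And>i R. i < p \<Longrightarrow> raises i R S' \<Longrightarrow> R \<in> K"
  shows "(\<Sum>R\<in>K. raise_matrix p R S * raise_matrix p R S') =
    (\<Sum>i<p. \<Sum>j<p. raise_weight p i * raise_weight p j * of_bool (\<exists>R. raises i R S' \<and> raises j R S))"
proof -
  \<comment> \<open>The factors are swapped so that \<open>i\<close> leads to \<open>S'\<close> and
    \<open>j\<close> to \<open>S\<close>, as in the right-hand side of
    \<open>raises_exchange\<close>.\<close>
  have "(\<Sum>R\<in>K. raise_matrix p R S * raise_matrix p R S') =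
    (\<Sum>R\<in>K. raise_matrix p R S' * raise_matrix p R S)"
    by (simp add: mult.commute)
  also have "\<dots> =
    (\<Sum>R\<in>K. \<Sum>i<p. \<Sum>j<p. raise_weight p i * raise_weight p j * of_bool (raises i R S' \<and> raises j R S))"
    unfolding raise_matrix_def sum_product by (intro sum.cong) (auto simp: of_bool_def)
  also have "\<dots> = (\<Sum>i<p. \<Sum>j<p. \<Sum>R\<in>K. raise_weight p i * raise_weight p j * of_bool (raises i R S' \<and> raises j R S))"
    by (subst sum.swap, intro sum.cong refl, subst sum.swap) simp
  also have "\<dots> = (\<Sum>i<p. \<Sum>j<p. raise_weight p i * raise_weight p j * of_bool (\<exists>R. raises i R S' \<and> raises j R S))"
    unfolding sum_distrib_left[symmetric]
    by (intro sum.cong refl, subst sum_of_bool_unique) (use assms in \<open>auto simp: raises_iff_lower\<close>)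
  finally show ?thesis .
qed

text \<open>Summation by parts: the squared weights at \<open>i\<close> and at \<open>i - 1\<close>
  differ by \<open>(i + 1) * (p - i) - i * (p - i + 1) = p - 2 * i\<close>.\<close>

lemma raise_weight_telescope:
  assumes "S \<subseteq> {..<Suc p}"
  shows "(\<Sum>i<p. (raise_weight p i)\<^sup>2 * (of_bool (i \<in> S) - of_bool (Suc i \<in> S)))
    = real (card S) * real p - 2 * real (\<Sum>S)"
proof -
  let ?x = "\<lambda>i. of_bool (i \<in> S) :: real"
  have sq: "(raise_weight p i)\<^sup>2 = real (Suc i) * (real p - real i)" if "i < p" for i
    using that by (simp add: raise_weight_def)
  have "(\<Sum>i<p. (raise_weight p i)\<^sup>2 * (?x i - ?x (Suc i)))
     = (\<Sum>i<p. real (Suc i) * (real p - real i) * ?x i)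
       - (\<Sum>i<p. real (Suc i) * (real p - real i) * ?x (Suc i))"
    unfolding sum_subtractf[symmetric]
    by (intro sum.cong) (simp_all add: sq right_diff_distrib)
  \<comment> \<open>The added term at \<open>i = p\<close> vanishes by the factor
    \<open>p - i\<close>; after the shift in the next step, the added term at \<open>i = 0\<close>
    vanishes by the factor \<open>i\<close>.\<close>
  also have "(\<Sum>i<p. real (Suc i) * (real p - real i) * ?x i)
     = (\<Sum>i<Suc p. real (Suc i) * (real p - real i) * ?x i)"
    by simp
  also have "(\<Sum>i<p. real (Suc i) * (real p - real i) * ?x (Suc i))
     = (\<Sum>i<Suc p. real i * (real p - real i + 1) * ?x i)"
    by (subst sum.lessThan_Suc_shift) simp
  also have "(\<Sum>i<Suc p. real (Suc i) * (real p - real i) * ?x i)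
      - (\<Sum>i<Suc p. real i * (real p - real i + 1) * ?x i)
     = (\<Sum>i<Suc p. if i \<in> S then real p - 2 * real i else 0)"
    unfolding sum_subtractf[symmetric] by (intro sum.cong) (auto simp: algebra_simps)
  also have "\<dots> = (\<Sum>i\<in>S. real p - 2 * real i)"
    using assms by (subst sum.inter_restrict[symmetric]) (auto simp: Int_absorb1)
  also have "\<dots> = real (card S) * real p - 2 * real (\<Sum>S)"
    by (simp add: sum_subtractf sum_distrib_left)
  finally show ?thesis .
qed

text \<open>The weights are those of the $(p+1)$-dimensional irreducible representation of
  $\mathfrak{sl}_2$ in an orthonormal basis, so the raising matrix acts on its $k$-th exterior
  power and its commutator with the transpose is the weight operator.\<close>

lemma raise_matrix_commutator:
  assumes "S \<in> k_subsets (Suc p) k" "S' \<in> k_subsets (Suc p) k"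
  shows "(\<Sum>T\<in>k_subsets (Suc p) k. raise_matrix p S T * raise_matrix p S' T)
       - (\<Sum>R\<in>k_subsets (Suc p) k. raise_matrix p R S * raise_matrix p R S')
       = (if S = S' then real k * real p - 2 * real (\<Sum>S) else 0)"
proof -
  let ?w = "raise_weight p"
  let ?u = "\<lambda>i j. of_bool (\<exists>T. raises i S T \<and> raises j S' T) :: real"
  let ?d = "\<lambda>i j. of_bool (\<exists>R. raises i R S' \<and> raises j R S) :: real"
  have "(\<Sum>T\<in>k_subsets (Suc p) k. raise_matrix p S T * raise_matrix p S' T)
       - (\<Sum>R\<in>k_subsets (Suc p) k. raise_matrix p R S * raise_matrix p R S')
     = (\<Sum>i<p. \<Sum>j<p. ?w i * ?w j * ?u i j) - (\<Sum>i<p. \<Sum>j<p. ?w i * ?w j * ?d i j)"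
    by (subst raise_matrix_product, simp, use raises_k_subsets assms in blast,
        subst raise_matrix_product_transpose, simp, use raises_k_subsets assms in blast) simp
  also have "\<dots> = (\<Sum>i<p. \<Sum>j<p. if i = j then (?w i)\<^sup>2 * (?u i i - ?d i i) else 0)"
    unfolding sum_subtractf[symmetric]
    by (intro sum.cong refl) (auto simp: raises_exchange power2_eq_square algebra_simps)
  also have "\<dots> = (\<Sum>i<p. (?w i)\<^sup>2 * (?u i i - ?d i i))"
    by (intro sum.cong refl) simp
  also have "\<dots> = (if S = S' then real k * real p - 2 * real (\<Sum>S) else 0)"
  proof (cases "S = S'")
    case True
    have "(\<Sum>i<p. (?w i)\<^sup>2 * (?u i i - ?d i i))
      = (\<Sum>i<p. (?w i)\<^sup>2 * (of_bool (i \<in> S) - of_bool (Suc i \<in> S)))"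
    proof (intro sum.cong refl arg_cong2[where f = "(*)"])
      fix i
      have "(\<exists>T. raises i S T) \<longleftrightarrow> i \<in> S \<and> Suc i \<notin> S" by (simp add: raises_def)
      moreover have "(\<exists>R. raises i R S) \<longleftrightarrow> Suc i \<in> S \<and> i \<notin> S" by (simp add: raises_iff_lower)
      ultimately show "?u i i - ?d i i = of_bool (i \<in> S) - of_bool (Suc i \<in> S)"
        using True by auto
    qed
    then show ?thesis
      using True assms raise_weight_telescope[of S p] by (simp add: k_subsets_def)
  next
    case False
    \<comment> \<open>A move is invertible, so two sets with the same result (or the same origin)
      under the same move \<open>i\<close> coincide.\<close>
    then have "\<not> (\<exists>T. raises i S T \<and> raises i S' T)" for i by (auto simp: raises_iff_lower)
    moreover have "\<not> (\<exists>R. raises i R S' \<and> raises i R S)" for i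
      using False by (auto simp: raises_def)
    ultimately show ?thesis using False by (simp only: of_bool_eq) simp
  qed
  finally show ?thesis .
qed

section \<open>Norm identity and monotonicity of the counts\<close>

lemma sum_square_expand:
  fixes M :: "'a \<Rightarrow> 'b \<Rightarrow> real"
  shows "(\<Sum>T\<in>L. (\<Sum>S\<in>K. M S T * f S)\<^sup>2)
    = (\<Sum>S\<in>K. \<Sum>S'\<in>K. f S * f S' * (\<Sum>T\<in>L. M S T * M S' T))"
proof -
  have "(\<Sum>T\<in>L. (\<Sum>S\<in>K. M S T * f S)\<^sup>2)
    = (\<Sum>T\<in>L. \<Sum>S\<in>K. \<Sum>S'\<in>K. f S * f S' * (M S T * M S' T))"
    unfolding power2_eq_square sum_product by (intro sum.cong) auto
  also have "\<dots> = (\<Sum>S\<in>K. \<Sum>S'\<in>K. \<Sum>T\<in>L. f S * f S' * (M S T * M S' T))"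
    by (subst sum.swap, intro sum.cong refl, subst sum.swap) simp
  finally show ?thesis by (simp add: sum_distrib_left)
qed

text \<open>The commutator as a quadratic form: the left side is the squared norm of
  \<open>U f\<close> minus that of the transpose applied to \<open>f\<close>. For \<open>f\<close>
  supported on a single subset sum, the right side has a fixed sign.\<close>

lemma raise_matrix_norms:
  fixes f :: "nat set \<Rightarrow> real" and k p :: nat
  defines "K \<equiv> k_subsets (Suc p) k"
  shows "(\<Sum>T\<in>K. (\<Sum>S\<in>K. raise_matrix p S T * f S)\<^sup>2)
       - (\<Sum>R\<in>K. (\<Sum>S\<in>K. raise_matrix p R S * f S)\<^sup>2)
       = (\<Sum>S\<in>K. (real k * real p - 2 * real (\<Sum>S)) * (f S)\<^sup>2)"
proof -
  have "(\<Sum>T\<in>K. (\<Sum>S\<in>K. raise_matrix p S T * f S)\<^sup>2)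
       - (\<Sum>R\<in>K. (\<Sum>S\<in>K. raise_matrix p R S * f S)\<^sup>2)
     = (\<Sum>S\<in>K. \<Sum>S'\<in>K. f S * f S' *
         ((\<Sum>T\<in>K. raise_matrix p S T * raise_matrix p S' T)
         - (\<Sum>R\<in>K. raise_matrix p R S * raise_matrix p R S')))"
    unfolding sum_square_expand
      sum_square_expand[where M = "\<lambda>S R. raise_matrix p R S"]
    by (simp only: right_diff_distrib sum_subtractf)
  also have "\<dots> = (\<Sum>S\<in>K. \<Sum>S'\<in>K. if S = S' then (real k * real p - 2 * real (\<Sum>S)) * (f S)\<^sup>2 else 0)"
    by (intro sum.cong refl)
      (auto simp: K_def raise_matrix_commutator power2_eq_square simp del: of_nat_sum)
  also have "\<dots> = (\<Sum>S\<in>K. (real k * real p - 2 * real (\<Sum>S)) * (f S)\<^sup>2)"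
    by (intro sum.cong refl) (simp add: K_def)
  finally show ?thesis .
qed

lemma raise_matrix_eq_0:
  assumes "finite S" "\<Sum>T \<noteq> Suc (\<Sum>S)"
  shows "raise_matrix p S T = 0"
  unfolding raise_matrix_def
  by (intro sum.neutral) (use raises_sum[OF _ assms(1)] assms(2) in auto)

text \<open>If the count dropped, raising from sum \<open>s\<close> to \<open>Suc s\<close> would
  have a kernel vector. In the norm identity the first norm would then be zero, making the left side
  at most 0, while the right side is positive below the middle \<open>k * p / 2\<close>.\<close>

lemma subset_sum_count_le_Suc:
  assumes "2 * s < k * p"
  shows "subset_sum_count (Suc p) k s \<le> subset_sum_count (Suc p) k (Suc s)"
proof (rule ccontr)
  let ?K = "k_subsets (Suc p) k"
  let ?L = "\<lambda>s. {S \<in> ?K. \<Sum>S = s}"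
  assume "\<not> ?thesis"
  then obtain g where g: "\<exists>S\<in>?L s. g S \<noteq> 0"
    "\<And>T. T \<in> ?L (Suc s) \<Longrightarrow> (\<Sum>S\<in>?L s. raise_matrix p S T * g S) = 0"
    using nontrivial_kernel[of "?L (Suc s)" "?L s" "raise_matrix p"]
    by (auto simp: subset_sum_count_def simp del: mem_Collect_eq)
  \<comment> \<open>Extension by zero, so that the norm identity on all \<open>k\<close>-subsets
    applies.\<close>
  define f where "f = (\<lambda>S. if \<Sum>S = s then g S else 0)"
  have finS: "finite S" if "S \<in> ?K" for S
    using that finite_subset by (auto simp: k_subsets_def)
  have up: "(\<Sum>S\<in>?K. raise_matrix p S T * f S) = 0" if "T \<in> ?K" for T
  proof -
    have "(\<Sum>S\<in>?K. raise_matrix p S T * f S) = (\<Sum>S\<in>?L s. raise_matrix p S T * g S)"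
      by (rule sum.mono_neutral_cong_right) (auto simp: f_def)
    also have "\<dots> = 0"
    proof (cases "\<Sum>T = Suc s")
      case True
      then show ?thesis using g that by simp
    next
      case False
      then show ?thesis by (intro sum.neutral) (auto simp: raise_matrix_eq_0 finS)
    qed
    finally show ?thesis .
  qed
  have "(\<Sum>S\<in>?K. (real k * real p - 2 * real (\<Sum>S)) * (f S)\<^sup>2) \<le> 0"
    unfolding raise_matrix_norms[symmetric] by (simp add: up sum_nonneg)
  moreover have "(\<Sum>S\<in>?K. (real k * real p - 2 * real (\<Sum>S)) * (f S)\<^sup>2) > 0"
  proof -
    have pos: "real k * real p - 2 * real s > 0"
      using assms by (metis diff_gt_0_iff_gt of_nat_less_iff of_nat_mult of_nat_numeral)
    obtain S where S: "S \<in> ?K" "\<Sum>S = s" "g S \<noteq> 0" using g by auto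
    show ?thesis
      by (rule sum_pos2[of _ S]) (use S pos in \<open>auto simp: f_def simp del: of_nat_sum\<close>)
  qed
  ultimately show False by simp
qed

text \<open>The dual argument with the transpose. The kernel vector now lives at sum
  \<open>Suc s\<close>, which is why the hypothesis places \<open>Suc s\<close>, not
  \<open>s\<close>, above the middle.\<close>

lemma subset_sum_count_Suc_le:
  assumes "k * p < 2 * Suc s"
  shows "subset_sum_count (Suc p) k (Suc s) \<le> subset_sum_count (Suc p) k s"
proof (rule ccontr)
  let ?K = "k_subsets (Suc p) k"
  let ?L = "\<lambda>s. {S \<in> ?K. \<Sum>S = s}"
  assume "\<not> ?thesis"
  then obtain g where g: "\<exists>S\<in>?L (Suc s). g S \<noteq> 0"
    "\<And>R. R \<in> ?L s \<Longrightarrow> (\<Sum>S\<in>?L (Suc s). raise_matrix p R S * g S) = 0"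
    using nontrivial_kernel[of "?L s" "?L (Suc s)" "\<lambda>S R. raise_matrix p R S"]
    by (auto simp: subset_sum_count_def simp del: mem_Collect_eq)
  define f where "f = (\<lambda>S. if \<Sum>S = Suc s then g S else 0)"
  have finS: "finite S" if "S \<in> ?K" for S
    using that finite_subset by (auto simp: k_subsets_def)
  have down: "(\<Sum>S\<in>?K. raise_matrix p R S * f S) = 0" if "R \<in> ?K" for R
  proof -
    have "(\<Sum>S\<in>?K. raise_matrix p R S * f S) = (\<Sum>S\<in>?L (Suc s). raise_matrix p R S * g S)"
      by (rule sum.mono_neutral_cong_right) (auto simp: f_def)
    also have "\<dots> = 0"
    proof (cases "\<Sum>R = s")
      case True
      then show ?thesis using g that by simp
    next
      case False
      then show ?thesis by (intro sum.neutral) (auto simp: raise_matrix_eq_0 finS that)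
    qed
    finally show ?thesis .
  qed
  have "(\<Sum>S\<in>?K. (real k * real p - 2 * real (\<Sum>S)) * (f S)\<^sup>2) \<ge> 0"
    unfolding raise_matrix_norms[symmetric] by (simp add: down sum_nonneg)
  moreover have "(\<Sum>S\<in>?K. - ((real k * real p - 2 * real (\<Sum>S)) * (f S)\<^sup>2)) > 0"
  proof -
    have neg: "real k * real p - 2 * real (Suc s) < 0"
      using assms by (metis diff_less_0_iff_less of_nat_less_iff of_nat_mult of_nat_numeral)
    obtain S where S: "S \<in> ?K" "\<Sum>S = Suc s" "g S \<noteq> 0" using g by auto
    show ?thesis
      by (rule sum_pos2[of _ S])
        (use S neg in \<open>auto simp: f_def mult_less_0_iff mult_le_0_iff simp del: of_nat_sum of_nat_Suc\<close>)
  qed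
  ultimately show False by (simp add: sum_negf)
qed

lemma subset_sum_count_mono:
  assumes "i \<le> j" "2 * j \<le> k * p"
  shows "subset_sum_count (Suc p) k i \<le> subset_sum_count (Suc p) k j"
  using assms
proof (induction j rule: dec_induct)
  case (step j)
  then show ?case using subset_sum_count_le_Suc[of j k p] by simp
qed simp

lemma subset_sum_count_antimono:
  assumes "i \<le> j" "k * p < 2 * Suc i"
  shows "subset_sum_count (Suc p) k j \<le> subset_sum_count (Suc p) k i"
  using assms
proof (induction j rule: dec_induct)
  case (step j)
  then show ?case using subset_sum_count_Suc_le[of k p j] by simp
qed simp

section \<open>Gaussian polynomials\<close>

text \<open>The \<open>q\<close>-Pascal rule, giving Gaussian polynomials without division. The
  truncation of \<open>n - k\<close> for \<open>n < k\<close> is harmless because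
  \<open>gauss_poly n k\<close> is then 0.\<close>

fun gauss_poly :: "nat \<Rightarrow> nat \<Rightarrow> int poly" where
  "gauss_poly n 0 = 1"
| "gauss_poly 0 (Suc k) = 0"
| "gauss_poly (Suc n) (Suc k) = gauss_poly n (Suc k) + monom 1 (n - k) * gauss_poly n k"

lemma gauss_poly_eq_0: "n < k \<Longrightarrow> gauss_poly n k = 0"
  by (induction n k rule: gauss_poly.induct) auto

lemma k_subsets_0: "k_subsets n 0 = {{}}"
  by (auto simp: k_subsets_def dest: finite_subset)

lemma k_subsets_Suc:
  "k_subsets (Suc n) (Suc k) = k_subsets n (Suc k) \<union> insert n ` k_subsets n k"
proof (intro equalityI subsetI)
  fix S assume S: "S \<in> k_subsets (Suc n) (Suc k)"
  then have fin: "finite S" by (auto simp: k_subsets_def dest: finite_subset)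
  show "S \<in> k_subsets n (Suc k) \<union> insert n ` k_subsets n k"
  proof (cases "n \<in> S")
    case True
    then have "S = insert n (S - {n})" "S - {n} \<in> k_subsets n k"
      using S fin by (auto simp: k_subsets_def)
    then show ?thesis by blast
  next
    case False
    then have "S \<subseteq> {..<n}" using S by (auto simp: k_subsets_def less_Suc_eq)
    then show ?thesis using S by (auto simp: k_subsets_def)
  qed
next
  fix S assume S: "S \<in> k_subsets n (Suc k) \<union> insert n ` k_subsets n k"
  have "card (insert n T) = Suc (card T)" if "T \<subseteq> {..<n}" for T
    using that finite_subset by (subst card_insert_disjoint) auto
  then show "S \<in> k_subsets (Suc n) (Suc k)"
    using S by (auto simp: k_subsets_def)
qed

text \<open>The exponent \<open>k choose 2\<close> is the least possible sum
  \<open>0 + ... + (k - 1)\<close>. The \<open>q\<close>-Pascal rule matches the split of subsets by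
  whether they contain \<open>n\<close>.\<close>

lemma gauss_poly_subset_sum:
  "monom 1 (k choose 2) * gauss_poly n k = (\<Sum>S\<in>k_subsets n k. monom 1 (\<Sum>S))"
proof (induction n k rule: gauss_poly.induct)
  case (1 n)
  then show ?case by (simp add: k_subsets_0 binomial_eq_0)
next
  case (2 k)
  then show ?case by (simp add: k_subsets_def)
next
  case (3 n k)
  have nS: "n \<notin> S" "finite S" if "S \<in> k_subsets n k" for S k
    using that by (auto simp: k_subsets_def dest: finite_subset)
  have inj: "inj_on (insert n) (k_subsets n k)"
    using nS by (intro inj_onI) (metis insert_ident)
  have "(\<Sum>S\<in>k_subsets (Suc n) (Suc k). monom (1::int) (\<Sum>S))
      = (\<Sum>S\<in>k_subsets n (Suc k). monom 1 (\<Sum>S)) + (\<Sum>S\<in>insert n ` k_subsets n k. monom 1 (\<Sum>S))"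
    unfolding k_subsets_Suc by (intro sum.union_disjoint) (use nS in auto)
  also have "(\<Sum>S\<in>insert n ` k_subsets n k. monom (1::int) (\<Sum>S))
      = (\<Sum>S\<in>k_subsets n k. monom 1 n * monom 1 (\<Sum>S))"
    unfolding sum.reindex[OF inj] by (intro sum.cong) (use nS in \<open>auto simp: mult_monom\<close>)
  also have "\<dots> = monom 1 n * (monom 1 (k choose 2) * gauss_poly n k)"
    unfolding 3 by (simp add: sum_distrib_left)
  \<comment> \<open>For \<open>k \<le> n\<close> the exponents agree:
    \<open>(k choose 2) + n = (Suc k choose 2) + (n - k)\<close>. Otherwise both sides are
    0.\<close>
  also have "\<dots> = monom 1 (Suc k choose 2) * (monom 1 (n - k) * gauss_poly n k)"
  proof (cases "k \<le> n")
    case True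
    have "(Suc k choose 2) = (k choose 2) + k" by (simp add: numeral_2_eq_2)
    then show ?thesis using True by (simp add: mult_monom mult.assoc[symmetric] add.commute)
  qed (simp add: gauss_poly_eq_0)
  finally show ?case using 3 by (simp add: distrib_left)
qed

lemma coeff_gauss_poly_subset_sum_count:
  "coeff (monom 1 (k choose 2) * gauss_poly n k) s = int (subset_sum_count n k s)"
proof -
  have "coeff (monom 1 (k choose 2) * gauss_poly n k) s
      = (\<Sum>S\<in>k_subsets n k. if \<Sum>S = s then 1 else 0)"
    unfolding gauss_poly_subset_sum by (simp add: coeff_sum)
  also have "\<dots> = int (subset_sum_count n k s)"
    by (subst sum.inter_filter[symmetric]) (auto simp: subset_sum_count_def)
  finally show ?thesis .
qed

section \<open>Gaussian polynomials in the fraction field\<close>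

lemma qvar_power: "qvar ^ i = to_fract (monom 1 i)"
  by (induction i) (simp_all add: qvar_def monom_Suc flip: to_fract_mult)

lemma one_minus_qvar_power: "1 - qvar ^ i = to_fract (1 - monom 1 i)"
  by (simp add: qvar_power)

lemma one_minus_qvar_power_neq_0:
  assumes "i > 0"
  shows "1 - qvar ^ i \<noteq> 0"
proof -
  have "coeff (1 - monom 1 i :: int poly) 0 = 1" using assms by simp
  then have "(1 - monom 1 i :: int poly) \<noteq> 0" by (metis coeff_0 zero_neq_one)
  then show ?thesis unfolding one_minus_qvar_power by (simp only: to_fract_eq_0_iff not_False_eq_True)
qed

definition qfact :: "nat \<Rightarrow> int poly fract" where
  "qfact n = (\<Prod>i=1..n. 1 - qvar ^ i)"

lemma qfact_Suc: "qfact (Suc n) = (1 - qvar ^ Suc n) * qfact n"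
  by (simp add: qfact_def mult.commute)

lemma qfact_neq_0: "qfact n \<noteq> 0"
  using one_minus_qvar_power_neq_0 by (auto simp: qfact_def)

lemma qbinomial_qfact:
  "k \<le> n \<Longrightarrow> qbinomial qvar n k = qfact n / (qfact k * qfact (n - k))"
  by (simp add: qbinomial_def qfact_def)

text \<open>The quotient of factorials obeys the same recursion. For \<open>k < n\<close>, a common
  factor reduces this to \<open>(1 - q^(m+1)) + q^(m+1) * (1 - q^(k+1)) = 1 - q^(n+1)\<close> with
  \<open>n = k + m + 1\<close>.\<close>

lemma to_fract_gauss_poly: "to_fract (gauss_poly n k) = qbinomial qvar n k"
proof (induction n k rule: gauss_poly.induct)
  case (1 n)
  then show ?case using qfact_neq_0[of n] by (simp add: qbinomial_qfact) (simp add: qfact_def)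
next
  case (2 k)
  then show ?case by (simp add: qbinomial_def)
next
  case (3 n k)
  have eq: "to_fract (gauss_poly (Suc n) (Suc k))
      = qbinomial qvar n (Suc k) + qvar ^ (n - k) * qbinomial qvar n k"
    using 3 by (simp add: qvar_power)
  consider "k < n" | "k = n" | "k > n" by linarith
  then show ?case
  proof cases
    case 1
    define m where "m = n - Suc k"
    have n: "n = k + Suc m" using 1 by (simp add: m_def)
    note neq = qfact_neq_0[of k] qfact_neq_0[of m]
      one_minus_qvar_power_neq_0[of "Suc k"] one_minus_qvar_power_neq_0[of "Suc m"]
    have "qbinomial qvar n (Suc k) = qfact n / ((1 - qvar ^ Suc k) * qfact k * qfact m)"
      using n by (simp add: qbinomial_qfact qfact_Suc)
    also have "\<dots> = (1 - qvar ^ Suc m) * (qfact n / (qfact (Suc k) * qfact (Suc m)))"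
      using neq by (simp add: qfact_Suc del: power_Suc)
    finally have a: "qbinomial qvar n (Suc k) = \<dots>" .
    have "qbinomial qvar n k = qfact n / (qfact k * qfact (Suc m))"
      using n by (simp add: qbinomial_qfact)
    also have "\<dots> = (1 - qvar ^ Suc k) * (qfact n / (qfact (Suc k) * qfact (Suc m)))"
      using neq by (simp add: qfact_Suc del: power_Suc)
    finally have b: "qbinomial qvar n k = \<dots>" .
    have "n - k = Suc m" using n by simp
    then have "to_fract (gauss_poly (Suc n) (Suc k))
      = ((1 - qvar ^ Suc m) + qvar ^ Suc m * (1 - qvar ^ Suc k)) * (qfact n / (qfact (Suc k) * qfact (Suc m)))"
      unfolding eq a b by (simp only: distrib_right mult.assoc)
    also have "(1 - qvar ^ Suc m) + qvar ^ Suc m * (1 - qvar ^ Suc k) = 1 - qvar ^ Suc n"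
      unfolding n by (simp add: right_diff_distrib power_add)
    also have "(1 - qvar ^ Suc n) * (qfact n / (qfact (Suc k) * qfact (Suc m))) = qbinomial qvar (Suc n) (Suc k)"
      using n by (simp add: qbinomial_qfact qfact_Suc del: power_Suc)
    finally show ?thesis .
  next
    case 2
    then show ?thesis unfolding eq
      using qfact_neq_0[of n] qfact_neq_0[of "Suc n"]
      by (simp add: qbinomial_def flip: qfact_def) (simp add: qfact_def)
  next
    case 3
    then show ?thesis unfolding eq by (simp add: qbinomial_def)
  qed
qed

text \<open>This yields the divisibility of \<open>(1 - q^k)\<close> times the Gaussian polynomial
  by \<open>1 - q^(k+m)\<close>.\<close>

lemma qbinomial_absorb_numerator:
  assumes "k > 0"
  shows "(1 - qvar ^ k) * qbinomial qvar (k + m) k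
       = (1 - qvar ^ (k + m)) * qbinomial qvar (k + m - 1) (k - 1)"
proof -
  obtain l where k: "k = Suc l" using assms by (cases k) auto
  show ?thesis
    using qfact_neq_0[of l] qfact_neq_0[of m] one_minus_qvar_power_neq_0[of "Suc l"]
    by (simp add: k qbinomial_qfact qfact_Suc del: power_Suc)
qed

text \<open>Up to the factor \<open>1 - q^gcd\<close>, this is the equality of the two expressions
  in the final theorem.\<close>

lemma qbinomial_absorb_complement:
  "qbinomial qvar (k + m) k / (1 - qvar ^ Suc m)
     = qbinomial qvar (Suc (k + m)) k / (1 - qvar ^ Suc (k + m))"
proof -
  have "Suc (k + m) - k = Suc m" by simp
  then show ?thesis
    using qfact_neq_0[of k] qfact_neq_0[of m] one_minus_qvar_power_neq_0[of "Suc m"]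
      one_minus_qvar_power_neq_0[of "Suc (k + m)"]
    by (simp add: qbinomial_qfact qfact_Suc mult_ac del: power_Suc)
qed

section \<open>Division by \<open>1 - q ^ N\<close>\<close>

lemma one_minus_monom_dvd:
  "(1 - monom 1 m :: int poly) dvd 1 - monom 1 (m * x)"
proof -
  have "monom 1 (m * x) = (monom 1 m :: int poly) ^ x" by (simp add: monom_power mult.commute)
  then show ?thesis using power_diff_1_eq[of "monom 1 m :: int poly" x]
    by (metis dvd_triv_left minus_diff_eq minus_dvd_iff dvd_minus_iff)
qed

lemma one_minus_monom_dvd_gauss_poly:
  assumes "k > 0"
  shows "(1 - monom 1 (k + m)) dvd (1 - monom 1 (gcd k (k + m))) * gauss_poly (k + m) k"
proof -
  let ?N = "k + m"
  let ?d = "gcd k ?N"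
  have "to_fract ((1 - monom 1 k) * gauss_poly ?N k)
      = to_fract ((1 - monom 1 ?N) * gauss_poly (?N - 1) (k - 1))"
    using qbinomial_absorb_numerator[OF assms, of m]
    by (simp only: to_fract_mult to_fract_gauss_poly one_minus_qvar_power)
  then have "(1 - monom 1 k) * gauss_poly ?N k = (1 - monom 1 ?N) * gauss_poly (?N - 1) (k - 1)"
    unfolding to_fract_eq_iff .
  then have k: "(1 - monom 1 ?N) dvd (1 - monom 1 k) * gauss_poly ?N k" by simp
  \<comment> \<open>Bezout in the naturals, written without negative exponents; with
    \<open>d\<close> the gcd and \<open>N = k + m\<close>, it gives
    \<open>1 - q^d = (1 - q^(k*x)) - q^d * (1 - q^(N*y))\<close>.\<close>
  obtain x y where xy: "k * x = ?N * y + ?d"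
    using bezout_nat[of k ?N] assms by auto
  have "(1 - monom 1 k :: int poly) * gauss_poly ?N k dvd (1 - monom 1 (k * x)) * gauss_poly ?N k"
    by (intro mult_dvd_mono one_minus_monom_dvd) simp
  with k have 1: "(1 - monom 1 ?N) dvd (1 - monom 1 (k * x)) * gauss_poly ?N k"
    using dvd_trans by blast
  have 2: "(1 - monom 1 ?N) dvd (1 - monom 1 (?N * y)) * (monom 1 ?d * gauss_poly ?N k)"
    by (intro dvd_mult2 one_minus_monom_dvd)
  have "monom 1 (k * x) = (monom 1 (?N * y) * monom 1 ?d :: int poly)"
    unfolding xy mult_monom by simp
  then have "(1 - monom 1 ?d) * gauss_poly ?N k =
     (1 - monom 1 (k * x)) * gauss_poly ?N k - (1 - monom 1 (?N * y)) * (monom 1 ?d * gauss_poly ?N k)"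
    by (simp only: left_diff_distrib mult.assoc mult_1)
  with dvd_diff[OF 1 2] show ?thesis by simp
qed

section \<open>Non-negativity of the quotient\<close>

lemma coeff_one_minus_monom_mult:
  "coeff ((1 - monom 1 d) * p) j = coeff p j - (if d \<le> j then coeff p (j - d) else 0)"
  for p :: "'a::comm_ring_1 poly"
  by (simp add: left_diff_distrib coeff_monom_mult)

text \<open>Below the mode, the coefficients of \<open>R\<close> are built up from the increments of \<open>P\<close>; above
  it, they are built up from the decrements, starting beyond the degree of \<open>R\<close>.\<close>

lemma coeff_quotient_nonneg:
  fixes P R :: "int poly"
  assumes eq: "(1 - monom 1 N) * R = (1 - monom 1 d) * P"
    and "0 < d" "d \<le> N"
    and nonneg: "\<And>i. coeff P i \<ge> 0"
    and up: "\<And>i j. i \<le> j \<Longrightarrow> 2 * j \<le> M \<Longrightarrow> coeff P i \<le> coeff P j"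
    and down: "\<And>i j. i \<le> j \<Longrightarrow> M < 2 * Suc i \<Longrightarrow> coeff P j \<le> coeff P i"
  shows "coeff R j \<ge> 0"
proof -
  have rec: "coeff R j - (if N \<le> j then coeff R (j - N) else 0)
      = coeff P j - (if d \<le> j then coeff P (j - d) else 0)" for j
    using arg_cong[OF eq, of "\<lambda>p. coeff p j"] by (simp only: coeff_one_minus_monom_mult)
  have low: "2 * j \<le> M \<Longrightarrow> coeff R j \<ge> 0" for j
  proof (induction j rule: less_induct)
    case (less j)
    have "(if N \<le> j then coeff R (j - N) else 0) \<ge> 0"
      using less assms(2,3) by auto
    moreover have "coeff P j - (if d \<le> j then coeff P (j - d) else 0) \<ge> 0"
      using nonneg up[of "j - d" j] less.prems by auto
    ultimately show ?case using rec[of j] by linarith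
  qed
  \<comment> \<open>The recurrence at \<open>j + N\<close> is read backwards:
    \<open>R_j = R_(j+N) + P_(j+N-d) - P_(j+N)\<close>. As \<open>d \<le> N\<close>, the index
    \<open>j + N - d\<close> is at least \<open>j\<close>, hence still above the middle.\<close>
  have high: "M < 2 * j \<Longrightarrow> coeff R j \<ge> 0" for j
  proof (induction "Suc (degree R) - j" arbitrary: j rule: less_induct)
    case less
    show ?case
    proof (cases "j \<le> degree R")
      case True
      have "coeff R (j + N) \<ge> 0"
        using less.hyps[of "j + N"] less.prems True assms(2,3) by simp
      moreover have "coeff P (j + N) \<le> coeff P (j + N - d)"
        using less.prems assms(2,3) by (intro down) auto
      ultimately show ?thesis using rec[of "j + N"] assms(2,3) by simp
    qed (simp add: coeff_eq_0)
  qed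
  show ?thesis using low[of j] high[of j] by linarith
qed

theorem qbinomial_gcd_nonneg:
  assumes "k > 0"
  shows "is_nonneg_poly ((1 - qvar ^ gcd k (k + m)) / (1 - qvar ^ (k + m)) * qbinomial qvar (k + m) k)"
proof -
  let ?N = "k + m"
  let ?d = "gcd k ?N"
  obtain p where N: "?N = Suc p" using assms by (cases ?N) auto
  obtain T where T: "(1 - monom 1 ?d) * gauss_poly ?N k = (1 - monom 1 ?N) * T"
    using one_minus_monom_dvd_gauss_poly[OF assms] by blast
  \<comment> \<open>The shift turns the coefficients into subset sum counts for
    \<open>{0..p}\<close>, whose middle is \<open>k * p / 2\<close>; it is undone at the end by
    reading coefficients at \<open>j + (k choose 2)\<close>.\<close>
  let ?P = "monom 1 (k choose 2) * gauss_poly ?N k"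
  have c: "coeff ?P i = int (subset_sum_count (Suc p) k i)" for i
    unfolding coeff_gauss_poly_subset_sum_count N ..
  have "coeff (monom 1 (k choose 2) * T) j \<ge> 0" for j
  proof (rule coeff_quotient_nonneg[where N = ?N and d = ?d and P = ?P and M = "k * p"])
    show "(1 - monom 1 ?N) * (monom 1 (k choose 2) * T) = (1 - monom 1 ?d) * ?P"
      using T by (simp only: mult.left_commute[of _ "monom 1 (k choose 2)"])
    show "0 < ?d" "?d \<le> ?N" using assms by (simp, intro gcd_le2_nat) simp
  qed (auto simp only: c of_nat_le_iff of_nat_0_le_iff intro: subset_sum_count_mono subset_sum_count_antimono)
  from this[of "_ + (k choose 2)"] have "coeff T j \<ge> 0" for j
    by (simp add: coeff_monom_mult)
  moreover have "(1 - qvar ^ ?d) * qbinomial qvar ?N k = (1 - qvar ^ ?N) * to_fract T"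
    using arg_cong[OF T, of to_fract]
    by (simp only: to_fract_mult to_fract_gauss_poly one_minus_qvar_power)
  then have "(1 - qvar ^ ?d) / (1 - qvar ^ ?N) * qbinomial qvar ?N k = to_fract T"
    using one_minus_qvar_power_neq_0[of ?N] assms by (simp only: times_divide_eq_left) simp
  ultimately show ?thesis unfolding is_nonneg_poly_def by blast
qed

theorem theorem3p3:
  fixes a b n :: nat
  assumes "a > 0" and "b > 0" and "n > 0"
  shows "(1 - qvar ^ gcd (a * n) (b * n + 1)) / (1 - qvar ^ (b * n + 1))
           * qbinomial qvar (a * n + b * n) (a * n)
         = (1 - qvar ^ gcd (a * n) (b * n + 1)) / (1 - qvar ^ (a * n + b * n + 1))
           * qbinomial qvar (a * n + b * n + 1) (a * n)
       \<and> is_nonneg_poly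
           ((1 - qvar ^ gcd (a * n) (b * n + 1)) / (1 - qvar ^ (b * n + 1))
             * qbinomial qvar (a * n + b * n) (a * n))"
proof -
  let ?k = "a * n" and ?m = "b * n"
  let ?g = "gcd ?k (?m + 1)"
  have eq: "(1 - qvar ^ ?g) / (1 - qvar ^ (?m + 1)) * qbinomial qvar (?k + ?m) ?k
         = (1 - qvar ^ ?g) / (1 - qvar ^ (?k + ?m + 1)) * qbinomial qvar (?k + ?m + 1) ?k"
    using arg_cong[OF qbinomial_absorb_complement[of ?k ?m], of "(*) (1 - qvar ^ ?g)"]
    by simp
  \<comment> \<open>The general result is applied with total \<open>a * n + b * n + 1\<close>; its
    gcd with \<open>a * n\<close> equals the stated one.\<close>
  have "gcd ?k (?k + (?m + 1)) = ?g" by (rule gcd_add2)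
  then show ?thesis
    using eq qbinomial_gcd_nonneg[of ?k "?m + 1"] assms by (simp only: add.assoc) simp
qed

end
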